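(* For every integer $n\geq 1$ the following identities hold: \begin{gather*} 3x\bigl(B_{n}(x)-B_{n-1}(x)\bigr)=C_{2n-1}(x)-(36x^2-6x-2)\sum_{k=1}^{n-1}B_k(x)C_{2(n-k)-1}(x),\\ B_{n}(x)-(18x^2-1)B_{n-1}(x)=C_{2(n-1)}(x)-(36x^2-6x-2)\sum_{k=1}^{n-1}B_k(x)C_{2(n-k-1)}(x),\\ B_{2n+1}(x)-3xB_{2n-1}(x)=C_{n}(x)+C_{n-1}(x)+(36x^2-6x-2)\sum_{k=0}^{n-1}B_{2k+1}(x)C_{n-k-1}(x),\\ B_{2n}(x)-3xB_{2(n-1)}(x)=6xC_{n-1}(x)+(36x^2-6x-2)\sum_{k=1}^{n-1}B_{2k}(x)C_{n-k-1}(x). \end{gather*}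
   Context: The balancing polynomials $B_n(x)$ and Lucas-balancing polynomials $C_n(x)$, $n\geq 0$, are defined by the recurrence $u_n(x)=6xu_{n-1}(x)-u_{n-2}(x)$ for $n\geq 2$, with initial terms $B_0(x)=0$, $B_1(x)=1$ and $C_0(x)=1$, $C_1(x)=3x$. Empty sums are equal to $0$. *)

theory Defs
  imports "HOL-Computational_Algebra.Polynomial"
begin

(* The variable x is the indeterminate monom 1 1 of the polynomial ring. *)

fun balancing_poly :: "nat \<Rightarrow> 'a::comm_ring_1 poly" where
  "balancing_poly 0 = 0"
| "balancing_poly (Suc 0) = 1"
| "balancing_poly (Suc (Suc n)) = 6 * monom 1 1 * balancing_poly (Suc n) - balancing_poly n"

fun lucas_balancing_poly :: "nat \<Rightarrow> 'a::comm_ring_1 poly" where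
  "lucas_balancing_poly 0 = 1"
| "lucas_balancing_poly (Suc 0) = 3 * monom 1 1"
| "lucas_balancing_poly (Suc (Suc n)) =
     6 * monom 1 1 * lucas_balancing_poly (Suc n) - lucas_balancing_poly n"

end

theory Submission
  imports Defs
begin

text \<open>If \<open>p\<close> and \<open>q\<close> satisfy \<open>u (k + 2) = y * u (k + 1) - u k\<close> with parameters \<open>y\<close> and \<open>z\<close>,
  their convolution multiplied by \<open>z - y\<close> telescopes. Along even or odd indices the balancing
  recurrence persists with \<open>6x\<close> replaced by \<open>36x\<^sup>2 - 2\<close>, and the difference of the two parameters
  is the factor \<open>36x\<^sup>2 - 6x - 2\<close>. Each identity pairs one sequence of either kind.\<close>

text \<open>The two factors \<open>z * q 0 - q 1\<close> and \<open>y * p 0 - p 1\<close> are the values at index \<open>-1\<close>.\<close>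

lemma convolution_second_order_recurrences:
  fixes p q :: "nat \<Rightarrow> 'a::comm_ring_1"
  assumes p: "\<And>k. p (Suc (Suc k)) = y * p (Suc k) - p k"
    and q: "\<And>k. q (Suc (Suc k)) = z * q (Suc k) - q k"
  shows "(z - y) * (\<Sum>k\<le>m. p k * q (m - k)) =
    p 0 * q (Suc m) - p (Suc m) * q 0 + p m * (z * q 0 - q 1) - (y * p 0 - p 1) * q m"
proof (induction m rule: induct_nat_012)
  case 0
  show ?case by (simp add: algebra_simps)
next
  case 1
  show ?case by (simp add: p q algebra_simps)
next
  case (ge2 m)
  define S where "S = (\<lambda>m. \<Sum>k\<le>m. p k * q (m - k))"
  have S_Suc: "S (Suc i) = p 0 * q (Suc i) + (\<Sum>k\<le>i. p (Suc k) * q (i - k))" for i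
    unfolding S_def by (simp add: sum.atMost_Suc_shift del: sum.atMost_Suc)
  \<comment> \<open>Once the two lowest terms are split off, the recurrence of \<open>p\<close>
    applies inside the sum. So \<open>S\<close> inherits it up to boundary terms.\<close>
  have "S (Suc (Suc m)) =
      p 0 * q (Suc (Suc m)) + p 1 * q (Suc m) + (\<Sum>k\<le>m. p (Suc (Suc k)) * q (m - k))"
    by (subst S_Suc) (simp add: sum.atMost_Suc_shift del: sum.atMost_Suc)
  also have "(\<Sum>k\<le>m. p (Suc (Suc k)) * q (m - k)) =
      y * (\<Sum>k\<le>m. p (Suc k) * q (m - k)) - S m"
    unfolding S_def p by (simp add: left_diff_distrib sum_subtractf sum_distrib_left mult.assoc)
  also have "(\<Sum>k\<le>m. p (Suc k) * q (m - k)) = S (Suc m) - p 0 * q (Suc m)"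
    by (simp add: S_Suc)
  finally have "S (Suc (Suc m)) =
      y * S (Suc m) - S m + (p 0 * q (Suc (Suc m)) + (p 1 - y * p 0) * q (Suc m))"
    by (simp add: algebra_simps)
  \<comment> \<open>The factor \<open>z - y\<close> is moved onto \<open>S (Suc m)\<close> and
    \<open>S m\<close>, where both induction hypotheses apply.\<close>
  then have S_rec: "(z - y) * S (Suc (Suc m)) =
      y * ((z - y) * S (Suc m)) - (z - y) * S m +
      (z - y) * (p 0 * q (Suc (Suc m)) + (p 1 - y * p 0) * q (Suc m))"
    by (simp only:) (simp add: algebra_simps)
  show ?case
    using S_rec[unfolded S_def ge2] by (simp add: p q algebra_simps)
qed

text \<open>The characteristic roots have sum \<open>y\<close> and product 1; their squares have sum
  \<open>y\<^sup>2 - 2\<close> and product 1.\<close>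

lemma second_order_recurrence_step_two:
  fixes u :: "nat \<Rightarrow> 'a::comm_ring_1"
  assumes u: "\<And>k. u (Suc (Suc k)) = y * u (Suc k) - u k"
  shows "u (Suc (Suc (Suc (Suc k)))) = (y\<^sup>2 - 2) * u (Suc (Suc k)) - u k"
  by (simp add: u algebra_simps power2_eq_square)

theorem theorem3:
  fixes n :: nat and x :: "'a::comm_ring_1 poly" and B C :: "nat \<Rightarrow> 'a poly"
  defines "x \<equiv> monom 1 1" and "B \<equiv> balancing_poly" and "C \<equiv> lucas_balancing_poly"
  assumes "n \<ge> 1"
  shows "(3 * x * (B n - B (n - 1)) =
           C (2 * n - 1)
           - (36 * x^2 - 6 * x - 2) * (\<Sum>k=1..n-1. B k * C (2 * (n - k) - 1)))
    \<and> (B n - (18 * x^2 - 1) * B (n - 1) =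
           C (2 * (n - 1))
           - (36 * x^2 - 6 * x - 2) * (\<Sum>k=1..n-1. B k * C (2 * (n - k - 1))))
    \<and> (B (2 * n + 1) - 3 * x * B (2 * n - 1) =
           C n + C (n - 1)
           + (36 * x^2 - 6 * x - 2) * (\<Sum>k=0..n-1. B (2 * k + 1) * C (n - k - 1)))
    \<and> (B (2 * n) - 3 * x * B (2 * (n - 1)) =
           6 * x * C (n - 1)
           + (36 * x^2 - 6 * x - 2) * (\<Sum>k=1..n-1. B (2 * k) * C (n - k - 1)))"
proof -
  obtain m where n: "n = Suc m"
    using \<open>n \<ge> 1\<close> by (cases n) auto
  have B0: "B 0 = 0" and B1: "B (Suc 0) = 1" and C0: "C 0 = 1" and C1: "C (Suc 0) = 3 * x"
    by (simp_all add: B_def C_def x_def)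
  have B: "B (Suc (Suc k)) = 6 * x * B (Suc k) - B k"
    and C: "C (Suc (Suc k)) = 6 * x * C (Suc k) - C k" for k
    by (simp_all add: B_def C_def x_def)
  have C2: "C 2 = 18 * x\<^sup>2 - 1"
    by (simp add: numeral_2_eq_2 C C0 C1 algebra_simps)
  have B2: "B 2 = 6 * x"
    by (simp add: numeral_2_eq_2 B B0 B1)
  define z where "z = (6 * x)\<^sup>2 - 2"
  have D: "36 * x\<^sup>2 - 6 * x - 2 = z - 6 * x"
    by (simp add: z_def power_mult_distrib)
  have B_two: "B (Suc (Suc (Suc (Suc k)))) = z * B (Suc (Suc k)) - B k"
    and C_two: "C (Suc (Suc (Suc (Suc k)))) = z * C (Suc (Suc k)) - C k" for k
    unfolding z_def
    by (rule second_order_recurrence_step_two, rule B, rule second_order_recurrence_step_two, rule C)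
  \<comment> \<open>Since \<open>B 0 = 0\<close>, a sum starting at 1 becomes a full
    convolution.\<close>
  have drop_0: "(\<Sum>k=1..m. f k) = (\<Sum>k\<le>m. f k)" if "f 0 = 0" for f :: "nat \<Rightarrow> 'a poly"
    using that by (intro sum.mono_neutral_left) (auto simp: Suc_le_eq)

  have sum1: "(\<Sum>k=1..n-1. B k * C (2 * (n - k) - 1)) = (\<Sum>k\<le>m. B k * C (2 * (m - k) + 1))"
    unfolding n by (subst drop_0[symmetric]) (auto simp: B0 Suc_diff_le intro!: sum.cong)
  have sum2: "(\<Sum>k=1..n-1. B k * C (2 * (n - k - 1))) = (\<Sum>k\<le>m. B k * C (2 * (m - k)))"
    unfolding n by (subst drop_0[symmetric]) (auto simp: B0 intro!: sum.cong)
  have sum3: "(\<Sum>k=0..n-1. B (2 * k + 1) * C (n - k - 1)) = (\<Sum>k\<le>m. B (2 * k + 1) * C (m - k))"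
    unfolding n by (simp add: atLeast0AtMost)
  have sum4: "(\<Sum>k=1..n-1. B (2 * k) * C (n - k - 1)) = (\<Sum>k\<le>m. B (2 * k) * C (m - k))"
    unfolding n by (subst drop_0[symmetric]) (auto simp: B0 intro!: sum.cong)

  \<comment> \<open>\<open>C\<close> extends evenly to negative indices, so the value of
    \<open>q\<close> at -1 is \<open>3 * x\<close>, the same as \<open>q 0\<close>.\<close>
  have id1: "(z - 6 * x) * (\<Sum>k\<le>m. B k * C (2 * (m - k) + 1)) =
      C (2 * m + 1) - 3 * x * (B (Suc m) - B m)"
    by (subst convolution_second_order_recurrences[where q = "\<lambda>k. C (2 * k + 1)"])
      (simp_all add: B C_two, simp add: B0 B1 C0 C1 C z_def numeral_3_eq_3 algebra_simps power2_eq_square)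
  \<comment> \<open>Now the value of \<open>q\<close> at -1 is \<open>z - C 2\<close>, which is the
    coefficient \<open>18 * x\<^sup>2 - 1\<close>.\<close>
  have id2: "(z - 6 * x) * (\<Sum>k\<le>m. B k * C (2 * (m - k))) =
      C (2 * m) - (B (Suc m) - (18 * x\<^sup>2 - 1) * B m)"
    by (subst convolution_second_order_recurrences[where q = "\<lambda>k. C (2 * k)"])
      (simp_all add: B C_two, simp add: B0 B1 C0 C2 z_def algebra_simps)
  \<comment> \<open>Here \<open>p\<close> has the parameter \<open>z\<close>, so the factor changes
    sign. The value of \<open>p\<close> at -1 is \<open>z - B 3 = -1\<close>, which produces the
    summand \<open>C m\<close>.\<close>
  have id3: "(6 * x - z) * (\<Sum>k\<le>m. B (2 * k + 1) * C (m - k)) =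
      C (Suc m) + C m - (B (2 * Suc m + 1) - 3 * x * B (2 * m + 1))"
    by (subst convolution_second_order_recurrences[where p = "\<lambda>k. B (2 * k + 1)"])
      (simp_all add: B_two C, simp add: B0 B1 C0 C1 B z_def numeral_3_eq_3 algebra_simps power2_eq_square)
  \<comment> \<open>The value of \<open>p\<close> at -1 is \<open>- B 2\<close>, hence the term
    \<open>6 * x * C m\<close>.\<close>
  have id4: "(6 * x - z) * (\<Sum>k\<le>m. B (2 * k) * C (m - k)) =
      6 * x * C m - (B (2 * Suc m) - 3 * x * B (2 * m))"
    by (subst convolution_second_order_recurrences[where p = "\<lambda>k. B (2 * k)"])
      (simp_all add: B_two C, simp add: B0 B2 C0 C1 algebra_simps)

  show ?thesis
    unfolding D sum1 sum2 sum3 sum4 id1 id2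
    using id3 id4 by (simp add: n algebra_simps)
qed

end
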